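(* For all integers $a,b\geq 0$, \[ h^\ast_{a,b}(t) \;=\; \sum_{i=0}^{\min(a,b)}\binom{2i}{i}\binom{a}{i}\binom{b}{i}\,t^i(1+t)^{a+b+1-2i}. \] In particular, $h^\ast_{a,b}(t)$ is $\gamma$-positive.
   Context: For a finite simple graph $G=(V,E)$ the symmetric edge polytope is $P_G=\mathrm{conv}(e_v-e_w,\,e_w-e_v : vw\in E)\subset\mathbb{R}^V$, where $e_v$ are the standard unit vectors. Let $K_{a+1,b+1}$ be the complete bipartite graph with parts of sizes $a+1$ and $b+1$. The polytope $P=P_{K_{a+1,b+1}}$ has dimension $d=a+b+1$, and its $h^\ast$-polynomial $h^\ast_{a,b}(t)$ is defined by $\sum_{n\geq 0}|nP\cap\mathbb{Z}^V|\,t^n = h^\ast_{a,b}(t)/(1-t)^{d+1}$. A polynomial $f$ of degree $d$ is $\gamma$-positive if $f(t)=\sum_{i\ge 0}\gamma_i t^i(1+t)^{d-2i}$ for some $\gamma_i\geq 0$. *)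

theory Defs
  imports
    "HOL-Analysis.Analysis"
    "HOL-Computational_Algebra.Computational_Algebra"
    "Graph_Theory.Kuratowski"
begin

(* The ambient space is R^'v. If verts G is a proper subset of UNIV, the polytope lies in the
   coordinate subspace R^(verts G), and lattice points and dimension are the same in both spaces. *)
definition symmetric_edge_polytope :: "('v::finite, 'e) pre_digraph \<Rightarrow> (real ^ 'v) set" where
  "symmetric_edge_polytope G =
     convex hull (\<Union>(v, w) \<in> arcs_ends G. {axis v 1 - axis w 1, axis w 1 - axis v 1})"

definition lattice_points :: "(real ^ 'v) set \<Rightarrow> (real ^ 'v) set" where
  "lattice_points S = {x \<in> S. \<forall>v. vec_nth x v \<in> \<int>}"

definition ehrhart_series :: "(real ^ 'v) set \<Rightarrow> real fps" where
  "ehrhart_series P = Abs_fps (\<lambda>n. real (card (lattice_points ((*\<^sub>R) (real n) ` P))))"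

(* A unique such h exists for every nonempty lattice polytope P. *)
definition h_star :: "(real ^ 'v::finite) set \<Rightarrow> real poly" where
  "h_star P = (THE h. ehrhart_series P = fps_of_poly h / (1 - fps_X) ^ (nat (aff_dim P) + 1))"

(* The sum stops at degree f div 2, the last index for which degree f - 2 * i is a
   genuine (untruncated) natural number. *)
definition gamma_positive :: "real poly \<Rightarrow> bool" where
  "gamma_positive f \<longleftrightarrow> (\<exists>\<gamma> :: nat \<Rightarrow> real. (\<forall>i. \<gamma> i \<ge> 0) \<and>
     f = (\<Sum>i \<le> degree f div 2. smult (\<gamma> i) (monom 1 i * [:1, 1:] ^ (degree f - 2 * i))))"

lemma h_star_eqI:
  fixes P :: "(real ^ 'v::finite) set"
  assumes "ehrhart_series P = fps_of_poly h / (1 - fps_X) ^ (nat (aff_dim P) + 1)"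
  shows "h_star P = h"
proof -
  let ?D = "(1 - fps_X :: real fps) ^ (nat (aff_dim P) + 1)"
  have D: "?D $ 0 \<noteq> 0" by (simp add: fps_power_zeroth)
  have *: "fps_of_poly q / ?D * ?D = fps_of_poly q" for q :: "real poly"
    using D by (simp add: fps_divide_unit mult.assoc inverse_mult_eq_1 del: power_Suc)
  show ?thesis
    unfolding h_star_def
  proof (rule the_equality)
    show "ehrhart_series P = fps_of_poly h / ?D" by (rule assms)
    fix q assume "ehrhart_series P = fps_of_poly q / ?D"
    with assms have "fps_of_poly q / ?D * ?D = fps_of_poly h / ?D * ?D" by simp
    then show "q = h" unfolding * fps_of_poly_eq_iff .
  qed
qed

end

theory Submission
  imports Defs
begin

text \<open>
  Let \<open>U\<close>, \<open>V\<close> be the parts of the graph and \<open>P\<close> the polytope. By linear programming duality \<open>n P\<close>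
  consists of the vectors of coordinate sum 0 whose restrictions to \<open>U\<close> and \<open>V\<close> have 1-norm at most \<open>n\<close>.
  After a sign change on \<open>V\<close>, its lattice points are pairs of integer vectors on \<open>U\<close> and \<open>V\<close> with equal
  sum and 1-norm at most \<open>n\<close>. Let \<open>A\<^sub>a(p, q)\<close> be the number of integer vectors with \<open>a + 1\<close> entries,
  sum \<open>p - q\<close> and 1-norm at most \<open>p + q\<close>. As sum and 1-norm have the same parity, the Ehrhart series is
  \<open>(1 + t) (\<Sum>p q. A\<^sub>a(p, q) A\<^sub>b(p, q) t\<^bsup>p+q\<^esup>)\<close>.
  Since \<open>A\<^sub>a(p, q)\<close> is a sum of products of a binomial coefficient in \<open>p\<close> and one in \<open>q\<close>, this double series
  reduces to the two classical series of products of binomial coefficients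
  \<open>(\<Sum>p. (p choose i) (p choose j) t\<^sup>p)\<close> and \<open>(\<Sum>q. (q + i choose i) (q + j choose j) t\<^sup>q)\<close>. Their
  numerators, summed over \<open>i\<close> and \<open>j\<close>, collapse to powers of \<open>1 + t\<close>, and
  \<open>(\<Sum>k. (m choose k)\<^sup>2) = (2 m choose m)\<close> produces the central binomial coefficient.
\<close>

section \<open>Integer vectors with bounded 1-norm and prescribed sum\<close>

lemma sum_binomial_Suc:
  fixes g :: "nat \<Rightarrow> nat"
  shows "(\<Sum>i\<le>Suc a. (Suc a choose i) * g i) =
    (\<Sum>i\<le>a. (a choose i) * g i) + (\<Sum>i\<le>a. (a choose i) * g (Suc i))"
proof -
  have "(\<Sum>i\<le>Suc a. (Suc a choose i) * g i) = g 0 + (\<Sum>i\<le>a. (Suc a choose Suc i) * g (Suc i))"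
    by (simp only: sum.atMost_Suc_shift) simp
  also have "\<dots> = (g 0 + (\<Sum>i\<le>a. (a choose Suc i) * g (Suc i))) + (\<Sum>i\<le>a. (a choose i) * g (Suc i))"
    by (simp add: sum.distrib algebra_simps)
  also have "g 0 + (\<Sum>i\<le>a. (a choose Suc i) * g (Suc i)) = (\<Sum>i\<le>Suc a. (a choose i) * g i)"
    by (simp only: sum.atMost_Suc_shift) simp
  finally show ?thesis by simp
qed

lemma sum_choose_diagonal: "(\<Sum>j<q. (j + m) choose m) = (q + m) choose Suc m"
  by (induction q) auto

text \<open>The coefficient of \<open>x\<^sup>p y\<^sup>q\<close> in \<open>(1 - x y)\<^sup>a / ((1 - x) (1 - y))\<^bsup>a+1\<^esup>\<close>, expanded
  with \<open>1 - x y = (1 - x) + x (1 - y)\<close>.\<close>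
definition signed_count :: "nat \<Rightarrow> nat \<Rightarrow> nat \<Rightarrow> nat" where
  "signed_count a p q = (\<Sum>i\<le>a. (a choose i) * ((p choose i) * ((q + (a - i)) choose (a - i))))"

text \<open>Hockey-stick sums raise one of the two lower indices, and Pascal's rule matches the
  terms. In generating functions:
  \<open>(1 - x y) / ((1 - x) (1 - y)) = 1 / (1 - x) + y / (1 - y)\<close>.\<close>

lemma signed_count_Suc:
  "signed_count (Suc a) p q = (\<Sum>i\<le>p. signed_count a i q) + (\<Sum>j<q. signed_count a p j)"
proof -
  have 1: "(\<Sum>k\<le>p. signed_count a k q) =
      (\<Sum>i\<le>a. (a choose i) * ((Suc p choose Suc i) * ((q + (a - i)) choose (a - i))))"
    unfolding signed_count_def
    by (subst sum.swap) (simp only: sum_distrib_left[symmetric] sum_distrib_right[symmetric] sum_choose_upper)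
  have 2: "(\<Sum>j<q. signed_count a p j) =
      (\<Sum>i\<le>a. (a choose i) * ((p choose i) * ((q + (a - i)) choose Suc (a - i))))"
    unfolding signed_count_def
    by (subst sum.swap) (simp only: sum_distrib_left[symmetric] sum_choose_diagonal)
  have 3: "signed_count (Suc a) p q =
     (\<Sum>i\<le>a. (a choose i) * ((p choose i) * ((q + (Suc a - i)) choose (Suc a - i)))) +
     (\<Sum>i\<le>a. (a choose i) * ((p choose Suc i) * ((q + (a - i)) choose (a - i))))"
    unfolding signed_count_def sum_binomial_Suc by simp
  show ?thesis
    unfolding 1 2 3 sum.distrib[symmetric]
    by (rule sum.cong) (auto simp: Suc_diff_le algebra_simps)
qed

text \<open>Equivalently, the positive parts of the entries add up to \<open>p - e\<close> and the
  negative parts to \<open>q - e\<close> for some \<open>e \<ge> 0\<close>.\<close>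

definition signed_fns :: "'a set \<Rightarrow> nat \<Rightarrow> nat \<Rightarrow> ('a \<Rightarrow> int) set" where
  "signed_fns U p q = {f. (\<forall>v. v \<notin> U \<longrightarrow> f v = 0) \<and> (\<Sum>v\<in>U. f v) = int p - int q \<and>
     (\<Sum>v\<in>U. \<bar>f v\<bar>) \<le> int p + int q}"

lemma finite_bounded_fns:
  fixes n :: int
  assumes "finite U"
  shows "finite {f :: 'a \<Rightarrow> int. (\<forall>v. v \<notin> U \<longrightarrow> f v = 0) \<and> (\<Sum>v\<in>U. \<bar>f v\<bar>) \<le> n}"
proof (rule finite_subset)
  show "finite {f :: 'a \<Rightarrow> int. \<forall>v. (v \<in> U \<longrightarrow> f v \<in> {-n..n}) \<and> (v \<notin> U \<longrightarrow> f v = 0)}"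
    by (rule finite_set_of_finite_funs) (use assms in auto)
  have "\<bar>f v\<bar> \<le> n" if "(\<Sum>v\<in>U. \<bar>f v\<bar>) \<le> n" "v \<in> U" for f :: "'a \<Rightarrow> int" and v
    using that member_le_sum[of v U "\<lambda>v. \<bar>f v\<bar>"] assms by auto
  then show "{f :: 'a \<Rightarrow> int. (\<forall>v. v \<notin> U \<longrightarrow> f v = 0) \<and> (\<Sum>v\<in>U. \<bar>f v\<bar>) \<le> n} \<subseteq>
      {f. \<forall>v. (v \<in> U \<longrightarrow> f v \<in> {-n..n}) \<and> (v \<notin> U \<longrightarrow> f v = 0)}"
    by (force simp: abs_le_iff)
qed

lemma finite_signed_fns: "finite U \<Longrightarrow> finite (signed_fns U p q)"
  unfolding signed_fns_def by (rule finite_subset[OF _ finite_bounded_fns]) auto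

text \<open>A nonnegative entry \<open>c\<close> at \<open>z\<close> consumes \<open>c\<close> units
  of \<open>p\<close>, a negative one \<open>-c\<close> units of \<open>q\<close>; the two sums run
  over what remains. This is the recursion of \<open>signed_count\<close>.\<close>

lemma card_signed_fns_insert:
  fixes U :: "'a set"
  assumes U: "finite U" "z \<notin> U"
  shows "card (signed_fns (insert z U) p q) =
    (\<Sum>i\<le>p. card (signed_fns U i q)) + (\<Sum>j<q. card (signed_fns U p j))"
proof -
  define B where "B c = (if c \<ge> 0 then signed_fns U (p - nat c) q
    else signed_fns U p (q - nat (- c)))" for c :: int
  have upd: "(\<Sum>v\<in>U. h ((f(z := c)) v)) = (\<Sum>v\<in>U. h (f v))" for f :: "'a \<Rightarrow> int" and c and h :: "int \<Rightarrow> int"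
    using U by (intro sum.cong) auto
  have "bij_betw (\<lambda>(c, f). f(z := c)) (SIGMA c:{-int q..int p}. B c) (signed_fns (insert z U) p q)"
  proof (rule bij_betw_byWitness[where f' = "\<lambda>f. (f z, f(z := 0))"])
    show "\<forall>x\<in>(SIGMA c:{-int q..int p}. B c). (\<lambda>f. (f z, f(z := 0))) (case x of (c, f) \<Rightarrow> f(z := c)) = x"
      using U by (auto simp: B_def signed_fns_def fun_eq_iff split: if_splits)
    show "\<forall>f\<in>signed_fns (insert z U) p q. (case (f z, f(z := 0)) of (c, f) \<Rightarrow> f(z := c)) = f"
      by auto
    show "(\<lambda>(c, f). f(z := c)) ` (SIGMA c:{-int q..int p}. B c) \<subseteq> signed_fns (insert z U) p q"
      using U upd[of "\<lambda>x. x"] upd[of abs]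
      by (auto simp: B_def signed_fns_def split: if_splits)
    show "(\<lambda>f. (f z, f(z := 0))) ` signed_fns (insert z U) p q \<subseteq> (SIGMA c:{-int q..int p}. B c)"
    proof clarify
      fix f assume f: "f \<in> signed_fns (insert z U) p q"
      have s: "f z + (\<Sum>v\<in>U. f v) = int p - int q" "\<bar>f z\<bar> + (\<Sum>v\<in>U. \<bar>f v\<bar>) \<le> int p + int q"
        using f U by (auto simp: signed_fns_def)
      \<comment> \<open>Combined with the sum equation and the norm bound, this confines the entry
        to \<open>-q..p\<close>, so the subtractions in \<open>B\<close> are never
        truncated.\<close>
      have "\<bar>\<Sum>v\<in>U. f v\<bar> \<le> (\<Sum>v\<in>U. \<bar>f v\<bar>)" by (rule sum_abs)
      with s have r: "- int q \<le> f z" "f z \<le> int p" by linarith+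
      show "f z \<in> {-int q..int p} \<and> f(z := 0) \<in> B (f z)"
        using r s f U upd[of "\<lambda>x. x" f 0] upd[of abs f 0]
        by (auto simp: B_def signed_fns_def)
    qed
  qed
  then have "card (signed_fns (insert z U) p q) = card (SIGMA c:{-int q..int p}. B c)"
    by (rule bij_betw_same_card[symmetric])
  also have "\<dots> = (\<Sum>c\<in>{-int q..int p}. card (B c))"
    using U by (subst card_SigmaI) (auto simp: B_def finite_signed_fns)
  also have "\<dots> = (\<Sum>c\<in>{0..int p}. card (B c)) + (\<Sum>c\<in>{-int q..-1}. card (B c))"
    by (subst sum.union_disjoint[symmetric]) (auto intro!: sum.cong)
  also have "(\<Sum>c\<in>{0..int p}. card (B c)) = (\<Sum>i\<le>p. card (signed_fns U i q))"
    by (rule sum.reindex_bij_witness[where j = "\<lambda>c. p - nat c" and i = "\<lambda>i. int (p - i)"])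
       (auto simp: B_def nat_diff_distrib)
  also have "(\<Sum>c\<in>{-int q..-1}. card (B c)) = (\<Sum>j<q. card (signed_fns U p j))"
    by (rule sum.reindex_bij_witness[where j = "\<lambda>c. q - nat (- c)" and i = "\<lambda>j. int j - int q"])
       (auto simp: B_def)
  finally show ?thesis .
qed

lemma card_signed_fns_singleton: "card (signed_fns {u} p q) = 1"
proof -
  have "signed_fns {u} p q = {(\<lambda>_. 0)(u := int p - int q)}"
    by (auto simp: signed_fns_def fun_eq_iff)
  then show ?thesis by simp
qed

lemma card_signed_fns:
  assumes "finite U" "card U = Suc a"
  shows "card (signed_fns U p q) = signed_count a p q"
  using assms
proof (induction a arbitrary: U p q)
  case 0
  then obtain u where "U = {u}" by (metis One_nat_def card_1_singletonE)
  then show ?case by (simp add: card_signed_fns_singleton signed_count_def)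
next
  case (Suc a)
  then obtain z W where W: "U = insert z W" "z \<notin> W" "card W = Suc a"
    by (metis card_eq_SucD)
  with Suc.prems have "finite W" by simp
  with W show ?case
    by (simp add: card_signed_fns_insert signed_count_Suc Suc.IH)
qed

section \<open>Vectors with prescribed sum, split by parity\<close>

lemma abs_sum_parity:
  fixes f :: "'a \<Rightarrow> int"
  shows "even ((\<Sum>v\<in>U. \<bar>f v\<bar>) - (\<Sum>v\<in>U. f v))"
  unfolding sum_subtractf[symmetric] by (rule dvd_sum) (auto simp: abs_if)

definition sum_fns :: "'a set \<Rightarrow> nat \<Rightarrow> int \<Rightarrow> ('a \<Rightarrow> int) set" where
  "sum_fns U n s = {f. (\<forall>v. v \<notin> U \<longrightarrow> f v = 0) \<and> (\<Sum>v\<in>U. f v) = s \<and> (\<Sum>v\<in>U. \<bar>f v\<bar>) \<le> int n}"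

lemma finite_sum_fns: "finite U \<Longrightarrow> finite (sum_fns U n s)"
  unfolding sum_fns_def by (rule finite_subset[OF _ finite_bounded_fns]) auto

lemma sum_fns_even: "p \<le> n \<Longrightarrow> sum_fns U n (2 * int p - int n) = signed_fns U p (n - p)"
  by (auto simp: sum_fns_def signed_fns_def of_nat_diff)

text \<open>The prescribed sum has the parity of \<open>n + 1\<close>. As 1-norm and sum agree
  modulo 2, norm \<open>n\<close> is impossible and the bound drops to \<open>n - 1\<close>.\<close>

lemma sum_fns_odd:
  assumes "p < n"
  shows "sum_fns U n (2 * int p - int n + 1) = signed_fns U p (n - 1 - p)"
proof -
  have "(\<Sum>v\<in>U. \<bar>f v\<bar>) \<le> int n \<longleftrightarrow> (\<Sum>v\<in>U. \<bar>f v\<bar>) \<le> int n - 1"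
    if "(\<Sum>v\<in>U. f v) = 2 * int p - int n + 1" for f :: "'a \<Rightarrow> int"
    using abs_sum_parity[of f U] that by presburger
  with assms show ?thesis
    by (auto simp: sum_fns_def signed_fns_def of_nat_diff)
qed

text \<open>The \<open>n + 1\<close> sums of the parity of \<open>n\<close> and the \<open>n\<close>
  sums of the other parity yield two consecutive coefficients of the same series; hence the factor
  \<open>1 + t\<close> in the Ehrhart series.\<close>

lemma sum_by_parity:
  fixes h :: "int \<Rightarrow> nat"
  shows "(\<Sum>s\<in>{-int n..int n}. h s) =
    (\<Sum>p\<le>n. h (2 * int p - int n)) + (\<Sum>p<n. h (2 * int p - int n + 1))"
proof -
  let ?e = "\<lambda>p. 2 * int p - int n" and ?o = "\<lambda>p. 2 * int p - int n + 1"
  have "{-int n..int n} = ?e ` {..n} \<union> ?o ` {..<n}"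
  proof (intro equalityI subsetI)
    fix s assume s: "s \<in> {-int n..int n}"
    from s obtain k where "s + int n = int k"
      using zero_le_imp_eq_int[of "s + int n"] by auto
    with s have k: "s = int k - int n" "k \<le> 2 * n" by auto
    show "s \<in> ?e ` {..n} \<union> ?o ` {..<n}"
    proof (cases "even k")
      case True
      then have "s = ?e (k div 2)" "k div 2 \<le> n" using k by auto
      then show ?thesis by blast
    next
      case False
      then have "s = ?o (k div 2)" using k(1) by presburger
      moreover have "k div 2 < n" using False k(2) by presburger
      ultimately show ?thesis by blast
    qed
  qed auto
  moreover have "?e ` {..n} \<inter> ?o ` {..<n} = {}" by auto presburger
  moreover have "inj ?e" "inj ?o" by (auto simp: inj_def)
  ultimately show ?thesis
    by (simp add: sum.union_disjoint sum.reindex inj_on_subset)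
qed

section \<open>Generating functions of products of binomial coefficients\<close>

text \<open>Vandermonde is used three times: to split the upper index as
  \<open>(i - k) + (p + j)\<close> with new index \<open>s\<close>, to sum over \<open>k\<close>,
  and, after regrouping trinomial products, to sum over \<open>s\<close>.\<close>

lemma binomial_mult_rising:
  "((p + i) choose i) * ((p + j) choose j) =
    (\<Sum>k\<le>i. (i choose k) * (j choose k) * ((p + i + j - k) choose (i + j)))"
proof -
  have 1: "(\<Sum>k\<le>i. (i choose k) * (j choose k) * ((i - k) choose s)) = (i choose s) * ((i + j - s) choose j)"
    if "s \<le> i" for s
  proof -
    have "(\<Sum>k\<le>i. (i choose k) * (j choose k) * ((i - k) choose s)) =
        (\<Sum>k\<le>i - s. (i choose s) * ((j choose k) * ((i - s) choose (i - s - k))))"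
    proof (rule sum.mono_neutral_cong_right)
      show "(i choose k) * (j choose k) * ((i - k) choose s) =
          (i choose s) * ((j choose k) * ((i - s) choose (i - s - k)))" if "k \<in> {..i - s}" for k
      proof -
        \<comment> \<open>Both sides count disjoint pairs of a \<open>k\<close>-subset and an
          \<open>s\<close>-subset of \<open>i\<close> elements.\<close>
        have "(i choose k) * ((i - k) choose s) = (i choose s) * ((i - s) choose k)"
        proof -
          have "(i choose (k + s)) * ((k + s) choose k) = (i choose k) * ((i - k) choose s)"
            using that \<open>s \<le> i\<close> choose_mult[of k "k + s" i] by simp
          moreover have "(i choose (k + s)) * ((k + s) choose s) = (i choose s) * ((i - s) choose k)"
            using that \<open>s \<le> i\<close> choose_mult[of s "k + s" i] by simp
          moreover have "(k + s) choose s = (k + s) choose k"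
            using binomial_symmetric[of s "k + s"] by simp
          ultimately show ?thesis by simp
        qed
        moreover have "(i - s) choose (i - s - k) = (i - s) choose k"
          using that binomial_symmetric[of k "i - s"] by simp
        ultimately show ?thesis by (simp add: algebra_simps)
      qed
    qed (auto simp: not_le binomial_eq_0)
    also have "\<dots> = (i choose s) * ((j + (i - s)) choose (i - s))"
      by (simp only: sum_distrib_left[symmetric] vandermonde)
    also have "(j + (i - s)) choose (i - s) = (i + j - s) choose j"
      using that binomial_symmetric[of j "i + j - s"] by (simp add: add.commute)
    finally show ?thesis .
  qed
  have "(\<Sum>k\<le>i. (i choose k) * (j choose k) * ((p + i + j - k) choose (i + j))) =
      (\<Sum>k\<le>i. (i choose k) * (j choose k) * (\<Sum>s\<le>i + j. ((i - k) choose s) * ((p + j) choose (i + j - s))))"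
    by (intro sum.cong refl) (simp add: vandermonde algebra_simps)
  also have "\<dots> = (\<Sum>k\<le>i. (i choose k) * (j choose k) * (\<Sum>s\<le>i. ((i - k) choose s) * ((p + j) choose (i + j - s))))"
    by (intro sum.cong refl arg_cong2[where f = "(*)"] sum.mono_neutral_right) (auto simp: binomial_eq_0)
  also have "\<dots> = (\<Sum>s\<le>i. (\<Sum>k\<le>i. (i choose k) * (j choose k) * ((i - k) choose s)) * ((p + j) choose (i + j - s)))"
    by (simp only: sum_distrib_left sum_distrib_right) (subst sum.swap, simp add: algebra_simps)
  also have "\<dots> = (\<Sum>s\<le>i. ((p + j) choose j) * ((i choose s) * (p choose (i - s))))"
  proof (rule sum.cong[OF refl], goal_cases)
    case (1 s)
    have "((p + j) choose (i + j - s)) * ((i + j - s) choose j) = ((p + j) choose j) * (p choose (i - s))"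
    proof (cases "i + j - s \<le> p + j")
      case True
      then show ?thesis using choose_mult[of j "i + j - s" "p + j"] 1 by simp
    qed (use 1 in \<open>simp add: binomial_eq_0\<close>)
    with 1 show ?case using \<open>\<And>s. s \<le> i \<Longrightarrow> _\<close> by (simp add: algebra_simps)
  qed
  also have "\<dots> = ((p + j) choose j) * ((i + p) choose i)"
    by (simp only: sum_distrib_left[symmetric] vandermonde)
  finally show ?thesis by (simp add: algebra_simps)
qed

text \<open>As for the rising product, now with the upper index split as \<open>k + p\<close>. The
  weights are the same in both expansions.\<close>

lemma binomial_mult_falling:
  "(p choose i) * (p choose j) = (\<Sum>k\<le>i. (i choose k) * (j choose k) * ((p + k) choose (i + j)))"
proof -
  have 1: "(\<Sum>k\<le>i. (i choose k) * (j choose k) * (k choose s)) = (i choose s) * ((i + j - s) choose i)"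
    if "s \<le> i" for s
  proof -
    have "(\<Sum>k\<le>i. (i choose k) * (j choose k) * (k choose s)) =
        (\<Sum>k\<le>i. (i choose s) * ((j choose k) * ((i - s) choose (i - k))))"
    proof (rule sum.cong[OF refl])
      fix k assume k: "k \<in> {..i}"
      have "(i choose k) * (k choose s) = (i choose s) * ((i - s) choose (i - k))"
      proof (cases "s \<le> k")
        case True
        have "(i - s) choose (k - s) = (i - s) choose (i - k)"
          using True k by (subst binomial_symmetric) auto
        then show ?thesis using choose_mult[of s k i] True k by simp
      qed (use k that in \<open>simp add: binomial_eq_0\<close>)
      then show "(i choose k) * (j choose k) * (k choose s) =
          (i choose s) * ((j choose k) * ((i - s) choose (i - k)))"
        by (simp add: algebra_simps)
    qed
    also have "\<dots> = (i choose s) * ((j + (i - s)) choose i)"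
      by (simp only: sum_distrib_left[symmetric] vandermonde)
    finally show ?thesis using that by (simp add: add.commute)
  qed
  have "(\<Sum>k\<le>i. (i choose k) * (j choose k) * ((p + k) choose (i + j))) =
      (\<Sum>k\<le>i. (i choose k) * (j choose k) * (\<Sum>s\<le>i + j. (k choose s) * (p choose (i + j - s))))"
    by (intro sum.cong refl) (simp add: vandermonde algebra_simps)
  also have "\<dots> = (\<Sum>k\<le>i. (i choose k) * (j choose k) * (\<Sum>s\<le>i. (k choose s) * (p choose (i + j - s))))"
    by (intro sum.cong refl arg_cong2[where f = "(*)"] sum.mono_neutral_right) (auto simp: binomial_eq_0)
  also have "\<dots> = (\<Sum>s\<le>i. (\<Sum>k\<le>i. (i choose k) * (j choose k) * (k choose s)) * (p choose (i + j - s)))"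
    by (simp only: sum_distrib_left sum_distrib_right) (subst sum.swap, simp add: algebra_simps)
  also have "\<dots> = (\<Sum>s\<le>i. (i choose s) * ((i + j - s) choose i) * (p choose (i + j - s)))"
    by (intro sum.cong refl) (simp add: 1)
  \<comment> \<open>The ranges differ only in zero terms: \<open>i choose s\<close> vanishes for
    \<open>s > i\<close>, and \<open>(i + j - s) choose i\<close> for
    \<open>j < s \<le> i\<close>.\<close>
  also have "\<dots> = (\<Sum>s\<le>j. (i choose s) * ((i + j - s) choose i) * (p choose (i + j - s)))"
    by (rule sum.mono_neutral_cong) (auto simp: binomial_eq_0)
  also have "\<dots> = (\<Sum>s\<le>j. (p choose i) * ((i choose s) * ((p - i) choose (j - s))))"
  proof (rule sum.cong[OF refl], goal_cases)
    case (1 s)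
    have "(p choose (i + j - s)) * ((i + j - s) choose i) = (p choose i) * ((p - i) choose (j - s))"
    proof (cases "i + j - s \<le> p")
      case True
      then show ?thesis using choose_mult[of i "i + j - s" p] 1 by simp
    next
      case False
      then have "p < i \<or> p - i < j - s" using 1 by auto
      then show ?thesis using False by (auto simp: binomial_eq_0)
    qed
    then show ?case by (simp add: algebra_simps)
  qed
  also have "\<dots> = (p choose i) * ((i + (p - i)) choose j)"
    by (simp only: sum_distrib_left[symmetric] vandermonde)
  also have "\<dots> = (p choose i) * (p choose j)" by (cases "i \<le> p") auto
  finally show ?thesis by simp
qed

section \<open>The two classical series in closed form\<close>

lemma inverse_one_minus_X_power:
  "inverse ((1 - fps_X :: real fps) ^ Suc m) = Abs_fps (\<lambda>n. of_nat ((n + m) choose m))"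
proof -
  have "inverse ((1 - fps_X :: real fps) ^ Suc m) = Abs_fps (\<lambda>n. of_nat ((m + n) choose n))"
    using one_minus_const_fps_X_neg_power'[of "Suc m" "1 :: real"] by simp
  moreover have "(m + n) choose n = (n + m) choose m" for n
    using binomial_symmetric[of m "m + n"] by (simp add: add.commute)
  ultimately show ?thesis by simp
qed

text \<open>The shift by \<open>i + j - k\<close> turns the coefficient
  \<open>(n + i + j) choose (i + j)\<close> into \<open>(p + k) choose (i + j)\<close>. This
  vanishes for \<open>p < i + j - k\<close>, so no boundary correction arises.\<close>

lemma fps_binomial_mult_falling:
  "Abs_fps (\<lambda>p. of_nat ((p choose i) * (p choose j)) :: real) =
    (\<Sum>k\<le>i. of_nat ((i choose k) * (j choose k)) * fps_X ^ (i + j - k)) *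
      inverse ((1 - fps_X) ^ Suc (i + j))" (is "_ = (\<Sum>k\<le>i. ?c k * ?X k) * ?I")
proof (rule fps_ext)
  fix p
  have "((\<Sum>k\<le>i. ?c k * ?X k) * ?I) $ p = (\<Sum>k\<le>i. (?c k * (?X k * ?I)) $ p)"
    by (simp only: sum_distrib_right fps_sum_nth mult.assoc)
  also have "\<dots> = (\<Sum>k\<le>i. of_nat ((i choose k) * (j choose k) * ((p + k) choose (i + j))))"
  proof (rule sum.cong[OF refl])
    fix k assume "k \<in> {..i}"
    then have "(?X k * ?I) $ p = of_nat ((p + k) choose (i + j))"
      unfolding inverse_one_minus_X_power
      by (auto simp: fps_X_power_mult_nth not_less intro!: arg_cong2[where f = binomial])
    then show "(?c k * (?X k * ?I)) $ p = of_nat ((i choose k) * (j choose k) * ((p + k) choose (i + j)))"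
      unfolding fps_mult_of_nat_nth by (simp only: of_nat_mult)
  qed
  finally show "Abs_fps (\<lambda>p. of_nat ((p choose i) * (p choose j)) :: real) $ p = ((\<Sum>k\<le>i. ?c k * ?X k) * ?I) $ p"
    by (simp only: binomial_mult_falling of_nat_sum[symmetric] fps_nth_Abs_fps)
qed

lemma fps_binomial_mult_rising:
  "Abs_fps (\<lambda>p. of_nat (((p + i) choose i) * ((p + j) choose j)) :: real) =
    (\<Sum>k\<le>i. of_nat ((i choose k) * (j choose k)) * fps_X ^ k) *
      inverse ((1 - fps_X) ^ Suc (i + j))" (is "_ = (\<Sum>k\<le>i. ?c k * ?X k) * ?I")
proof (rule fps_ext)
  fix p
  have "((\<Sum>k\<le>i. ?c k * ?X k) * ?I) $ p = (\<Sum>k\<le>i. (?c k * (?X k * ?I)) $ p)"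
    by (simp only: sum_distrib_right fps_sum_nth mult.assoc)
  also have "\<dots> = (\<Sum>k\<le>i. of_nat ((i choose k) * (j choose k) * ((p + i + j - k) choose (i + j))))"
  proof (rule sum.cong[OF refl])
    fix k assume "k \<in> {..i}"
    then have "(?X k * ?I) $ p = of_nat ((p + i + j - k) choose (i + j))"
      unfolding inverse_one_minus_X_power
      by (auto simp: fps_X_power_mult_nth not_less intro!: arg_cong2[where f = binomial])
    then show "(?c k * (?X k * ?I)) $ p = of_nat ((i choose k) * (j choose k) * ((p + i + j - k) choose (i + j)))"
      unfolding fps_mult_of_nat_nth by (simp only: of_nat_mult)
  qed
  finally show "Abs_fps (\<lambda>p. of_nat (((p + i) choose i) * ((p + j) choose j)) :: real) $ p = ((\<Sum>k\<le>i. ?c k * ?X k) * ?I) $ p"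
    by (simp only: binomial_mult_rising of_nat_sum[symmetric] fps_nth_Abs_fps)
qed

text \<open>Choosing an \<open>i\<close>-set with \<open>k\<close> marked elements inside and
  \<open>l\<close> outside amounts to choosing the \<open>k + l\<close> marked elements first, then
  the other \<open>i - k\<close> members of the set. The last choice, weighted by powers of
  \<open>x\<close>, is a binomial expansion.\<close>

lemma sum_binomial_split_power:
  fixes x :: "'a::comm_semiring_1"
  shows "(\<Sum>i\<le>a. of_nat ((a choose i) * (i choose k) * ((a - i) choose l)) * x ^ (i - k)) =
    of_nat ((a choose (k + l)) * ((k + l) choose k)) * (1 + x) ^ (a - (k + l))"
proof (cases "k + l \<le> a")
  case True
  have "(\<Sum>i\<le>a. of_nat ((a choose i) * (i choose k) * ((a - i) choose l)) * x ^ (i - k)) =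
      (\<Sum>i\<in>{k..a - l}. of_nat ((a choose i) * (i choose k) * ((a - i) choose l)) * x ^ (i - k))"
    using True by (intro sum.mono_neutral_right) (auto simp: binomial_eq_0 not_le)
  also have "\<dots> = (\<Sum>i\<le>a - (k + l). of_nat ((a choose (i + k)) * ((i + k) choose k) * ((a - (i + k)) choose l)) * x ^ i)"
    using True by (intro sum.reindex_bij_witness[where i = "\<lambda>i. i + k" and j = "\<lambda>i. i - k"]) auto
  also have "\<dots> = (\<Sum>i\<le>a - (k + l). of_nat ((a choose (k + l)) * ((k + l) choose k)) * (of_nat ((a - (k + l)) choose i) * x ^ i * 1 ^ (a - (k + l) - i)))"
  proof (rule sum.cong[OF refl], goal_cases)
    case (1 i)
    then have le: "i + k + l \<le> a" using True by simp
    have "(a choose (i + k)) * ((i + k) choose k) * ((a - (i + k)) choose l) =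
        (a choose (k + l)) * ((k + l) choose k) * ((a - (k + l)) choose i)"
    proof -
      have "(a choose (i + k)) * ((i + k) choose k) = (a choose k) * ((a - k) choose i)"
        using choose_mult[of k "i + k" a] le by simp
      moreover have "(a choose (k + l)) * ((k + l) choose k) = (a choose k) * ((a - k) choose l)"
        using choose_mult[of k "k + l" a] le by simp
      moreover have "((a - k) choose i) * ((a - (i + k)) choose l) = ((a - k) choose l) * ((a - (k + l)) choose i)"
        using choose_mult[of i "i + l" "a - k"] choose_mult[of l "i + l" "a - k"] le
          binomial_symmetric[of i "i + l"]
        by (simp add: add.commute)
      ultimately show ?thesis by (simp add: mult.assoc)
    qed
    then show ?case by (simp add: mult.assoc)
  qed
  also have "\<dots> = of_nat ((a choose (k + l)) * ((k + l) choose k)) * (x + 1) ^ (a - (k + l))"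
    by (simp only: sum_distrib_left[symmetric] binomial_ring)
  finally show ?thesis by (simp add: add.commute)
next
  case False
  have "(a choose i) * (i choose k) * ((a - i) choose l) = 0" for i
    using False by (cases "k \<le> i"; cases "i \<le> a"; cases "l \<le> a - i") (auto simp: binomial_eq_0)
  then show ?thesis using False by (simp only: of_nat_0 mult_zero_left sum.neutral_const) (simp add: binomial_eq_0)
qed

text \<open>The left side is the numerator of \<open>diagonal_series a b\<close>. With
  \<open>m = k + l\<close>, the sums over \<open>i\<close> and \<open>j\<close> each contribute a
  factor \<open>m choose k\<close>, and these squares add up to the central binomial
  coefficient.\<close>

lemma gamma_expansion:
  fixes x :: "'a::comm_semiring_1"
  shows "(\<Sum>i\<le>a. \<Sum>j\<le>b. of_nat ((a choose i) * (b choose j)) *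
      ((\<Sum>k\<le>i. of_nat ((i choose k) * (j choose k)) * x ^ (i + j - k)) *
       (\<Sum>l\<le>a - i. of_nat (((a - i) choose l) * ((b - j) choose l)) * x ^ l))) =
    (\<Sum>m\<le>a. of_nat (((2 * m) choose m) * (a choose m) * (b choose m)) * x ^ m * (1 + x) ^ (a + b - 2 * m))"
    (is "?L = ?R")
proof -
  let ?u = "\<lambda>i k l. of_nat ((a choose i) * (i choose k) * ((a - i) choose l)) * x ^ (i - k)"
  let ?v = "\<lambda>j k l. of_nat ((b choose j) * (j choose k) * ((b - j) choose l)) * x ^ (j - k)"
  \<comment> \<open>For fixed \<open>k\<close> and \<open>l\<close> the sums over \<open>i\<close> and \<open>j\<close> separate and are binomial expansions.\<close>
  have "?L = (\<Sum>i\<le>a. \<Sum>j\<le>b. \<Sum>k\<le>a. \<Sum>l\<le>a. x ^ (k + l) * (?u i k l * ?v j k l))"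
  proof (intro sum.cong refl, goal_cases)
    case (1 i j)
    \<comment> \<open>Splitting the exponent needs \<open>k \<le> j\<close>; for
      \<open>k > j\<close> the factor \<open>j choose k\<close> is 0. The range can grow to
      \<open>a\<close> because \<open>i choose k\<close> is 0 beyond \<open>i\<close>.\<close>
    have k: "(\<Sum>k\<le>i. of_nat ((i choose k) * (j choose k)) * x ^ (i + j - k)) =
        (\<Sum>k\<le>a. of_nat ((i choose k) * (j choose k)) * (x ^ k * x ^ (i - k) * x ^ (j - k)))"
    proof (rule sum.mono_neutral_cong_left)
      fix k assume "k \<in> {..i}"
      show "of_nat ((i choose k) * (j choose k)) * x ^ (i + j - k) =
          of_nat ((i choose k) * (j choose k)) * (x ^ k * x ^ (i - k) * x ^ (j - k))"
        using \<open>k \<in> {..i}\<close> by (cases "k \<le> j") (auto simp: binomial_eq_0 simp flip: power_add)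
    qed (use 1 in \<open>auto simp: binomial_eq_0\<close>)
    have l: "(\<Sum>l\<le>a - i. of_nat (((a - i) choose l) * ((b - j) choose l)) * x ^ l) =
        (\<Sum>l\<le>a. of_nat (((a - i) choose l) * ((b - j) choose l)) * x ^ l)"
      by (rule sum.mono_neutral_left) (auto simp: binomial_eq_0)
    show ?case
      unfolding k l sum_product unfolding sum_distrib_left
      by (intro sum.cong refl) (simp add: power_add algebra_simps)
  qed
  also have "\<dots> = (\<Sum>k\<le>a. \<Sum>l\<le>a. \<Sum>i\<le>a. \<Sum>j\<le>b. x ^ (k + l) * (?u i k l * ?v j k l))"
  proof -
    let ?w = "\<lambda>i j k l. x ^ (k + l) * (?u i k l * ?v j k l)"
    have "(\<Sum>i\<le>a. \<Sum>j\<le>b. \<Sum>k\<le>a. \<Sum>l\<le>a. ?w i j k l) = (\<Sum>i\<le>a. \<Sum>k\<le>a. \<Sum>j\<le>b. \<Sum>l\<le>a. ?w i j k l)"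
      by (rule sum.cong[OF refl], rule sum.swap)
    also have "\<dots> = (\<Sum>k\<le>a. \<Sum>i\<le>a. \<Sum>j\<le>b. \<Sum>l\<le>a. ?w i j k l)"
      by (rule sum.swap)
    also have "\<dots> = (\<Sum>k\<le>a. \<Sum>i\<le>a. \<Sum>l\<le>a. \<Sum>j\<le>b. ?w i j k l)"
      by (rule sum.cong[OF refl], rule sum.cong[OF refl], rule sum.swap)
    also have "\<dots> = (\<Sum>k\<le>a. \<Sum>l\<le>a. \<Sum>i\<le>a. \<Sum>j\<le>b. ?w i j k l)"
      by (rule sum.cong[OF refl], rule sum.swap)
    finally show ?thesis .
  qed
  also have "\<dots> = (\<Sum>k\<le>a. \<Sum>l\<le>a. x ^ (k + l) * ((\<Sum>i\<le>a. ?u i k l) * (\<Sum>j\<le>b. ?v j k l)))"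
    by (simp only: sum_distrib_left[symmetric] sum_distrib_right[symmetric])
  also have "\<dots> = (\<Sum>k\<le>a. \<Sum>l\<le>a. of_nat ((a choose (k + l)) * (b choose (k + l)) * ((k + l) choose k)\<^sup>2) *
       x ^ (k + l) * (1 + x) ^ (a + b - 2 * (k + l)))" (is "_ = (\<Sum>k\<le>a. \<Sum>l\<le>a. ?w k l)")
  proof (intro sum.cong refl, goal_cases)
    case (1 k l)
    show ?case
    \<comment> \<open>The exponents \<open>a - (k + l)\<close> and \<open>b - (k + l)\<close> add up
      as desired if neither is truncated; otherwise \<open>a choose (k + l)\<close> or
      \<open>b choose (k + l)\<close> is 0.\<close>
    proof (cases "k + l \<le> a \<and> k + l \<le> b")
      case True
      then have "a + b - 2 * (k + l) = (a - (k + l)) + (b - (k + l))" by simp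
      then show ?thesis
        unfolding sum_binomial_split_power by (simp only: power_add power2_eq_square of_nat_mult mult_ac)
    next
      case False
      then have "(a choose (k + l)) = 0 \<or> (b choose (k + l)) = 0" by (auto simp: binomial_eq_0)
      then show ?thesis unfolding sum_binomial_split_power by (auto simp: binomial_eq_0)
    qed
  qed
  also have "\<dots> = (\<Sum>(k, l)\<in>{..a} \<times> {..a}. ?w k l)"
    by (rule sum.cartesian_product)
  also have "\<dots> = (\<Sum>(k, l)\<in>{(k, l). k + l \<le> a}. ?w k l)"
  proof (rule sum.mono_neutral_right)
    show "\<forall>q\<in>{..a} \<times> {..a} - {(k, l). k + l \<le> a}. (case q of (k, l) \<Rightarrow> ?w k l) = 0"
    proof
      fix q assume "q \<in> {..a} \<times> {..a} - {(k, l). k + l \<le> a}"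
      then obtain k l where "q = (k, l)" "a < k + l" by (cases q) auto
      then show "(case q of (k, l) \<Rightarrow> ?w k l) = 0" by (simp add: binomial_eq_0)
    qed
  qed auto
  also have "\<dots> = (\<Sum>m\<le>a. \<Sum>k\<le>m. ?w k (m - k))"
    by (rule sum.triangle_reindex_eq)
  also have "\<dots> = ?R"
  proof (intro sum.cong refl, goal_cases)
    case (1 m)
    have "(\<Sum>k\<le>m. ?w k (m - k)) = (\<Sum>k\<le>m. of_nat ((m choose k)\<^sup>2) * (of_nat ((a choose m) * (b choose m)) * x ^ m * (1 + x) ^ (a + b - 2 * m)))"
      by (intro sum.cong refl) (simp add: algebra_simps)
    also have "\<dots> = of_nat ((2 * m) choose m) * (of_nat ((a choose m) * (b choose m)) * x ^ m * (1 + x) ^ (a + b - 2 * m))"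
      by (simp only: sum_distrib_right[symmetric] of_nat_sum[symmetric] choose_square_sum)
    finally show ?case by (simp add: mult.assoc)
  qed
  finally show ?thesis .
qed

section \<open>The series of products of two counts\<close>

definition diagonal_series :: "nat \<Rightarrow> nat \<Rightarrow> real fps" where
  "diagonal_series a b = Abs_fps (\<lambda>n. of_nat (\<Sum>p\<le>n. signed_count a p (n - p) * signed_count b p (n - p)))"

text \<open>Each summand of \<open>signed_count\<close> is a function of \<open>p\<close> times one
  of \<open>q\<close>, so the series is a combination of Cauchy products
  \<open>?P i j * ?Q (a - i) (b - j)\<close>.\<close>

lemma diagonal_series_eq:
  "diagonal_series a b =
    (\<Sum>m\<le>a. of_nat (((2 * m) choose m) * (a choose m) * (b choose m)) *
      fps_X ^ m * (1 + fps_X) ^ (a + b - 2 * m)) * inverse ((1 - fps_X) ^ (a + b + 2))"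
proof -
  let ?P = "\<lambda>i j. Abs_fps (\<lambda>p. of_nat ((p choose i) * (p choose j))) :: real fps"
  let ?Q = "\<lambda>i j. Abs_fps (\<lambda>q. of_nat (((q + i) choose i) * ((q + j) choose j))) :: real fps"
  let ?M = "\<lambda>i j. (\<Sum>k\<le>i. of_nat ((i choose k) * (j choose k)) * fps_X ^ (i + j - k)) :: real fps"
  let ?N = "\<lambda>i j. (\<Sum>k\<le>i. of_nat ((i choose k) * (j choose k)) * fps_X ^ k) :: real fps"
  have "diagonal_series a b = (\<Sum>i\<le>a. \<Sum>j\<le>b. of_nat ((a choose i) * (b choose j)) * (?P i j * ?Q (a - i) (b - j)))"
  proof (rule fps_ext)
    fix n
    let ?s = "\<lambda>i j p. of_nat ((a choose i) * (b choose j)) *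
      (of_nat ((p choose i) * (p choose j)) *
       of_nat (((n - p + (a - i)) choose (a - i)) * ((n - p + (b - j)) choose (b - j)))) :: real"
    have "diagonal_series a b $ n = (\<Sum>p\<le>n. \<Sum>i\<le>a. \<Sum>j\<le>b. ?s i j p)"
      unfolding diagonal_series_def signed_count_def sum_product fps_nth_Abs_fps of_nat_sum
      by (intro sum.cong refl) (simp add: mult_ac)
    also have "\<dots> = (\<Sum>i\<le>a. \<Sum>p\<le>n. \<Sum>j\<le>b. ?s i j p)"
      by (rule sum.swap)
    also have "\<dots> = (\<Sum>i\<le>a. \<Sum>j\<le>b. \<Sum>p\<le>n. ?s i j p)"
      by (rule sum.cong[OF refl], rule sum.swap)
    also have "\<dots> = (\<Sum>i\<le>a. \<Sum>j\<le>b. of_nat ((a choose i) * (b choose j)) * (\<Sum>p\<le>n. ?P i j $ p * ?Q (a - i) (b - j) $ (n - p)))"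
      by (simp only: sum_distrib_left fps_nth_Abs_fps)
    finally show "diagonal_series a b $ n =
        (\<Sum>i\<le>a. \<Sum>j\<le>b. of_nat ((a choose i) * (b choose j)) * (?P i j * ?Q (a - i) (b - j))) $ n"
      unfolding fps_sum_nth fps_mult_of_nat_nth unfolding fps_mult_nth atLeast0AtMost .
  qed
  also have "\<dots> = (\<Sum>i\<le>a. \<Sum>j\<le>b. of_nat ((a choose i) * (b choose j)) *
      (?M i j * ?N (a - i) (b - j)) * inverse ((1 - fps_X) ^ (a + b + 2)))"
  proof (intro sum.cong refl, goal_cases)
    case (1 i j)
    \<comment> \<open>The exponents of the two denominators have the same total for all
      \<open>i\<close> and \<open>j\<close>, which gives a common denominator.\<close>
    then have "a + b + 2 = Suc (i + j) + Suc (a - i + (b - j))" by simp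
    then have "inverse ((1 - fps_X :: real fps) ^ (a + b + 2)) =
        inverse ((1 - fps_X) ^ Suc (i + j)) * inverse ((1 - fps_X) ^ Suc (a - i + (b - j)))"
      by (simp only: power_add fps_inverse_mult)
    then show ?case
      unfolding fps_binomial_mult_falling fps_binomial_mult_rising by (simp only: mult_ac)
  qed
  finally show ?thesis
    by (simp only: sum_distrib_right[symmetric] gamma_expansion)
qed

section \<open>The polytope and its lattice points\<close>

locale bipartite_axes =
  fixes U V :: "'v::finite set"
  assumes disjoint: "U \<inter> V = {}" and nonempty: "U \<noteq> {}" "V \<noteq> {}"
begin

definition axis_differences :: "(real ^ 'v) set" where
  "axis_differences = (\<Union>(v, w) \<in> U \<times> V \<union> V \<times> U. {axis v 1 - axis w 1, axis w 1 - axis v 1})"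

text \<open>The inequality description of the dilate \<open>r P\<close> for
  \<open>r \<ge> 0\<close>; see \<open>convex_hull_axis_differences\<close> and
  \<open>scaleR_norm_region\<close>.\<close>

definition norm_region :: "real \<Rightarrow> (real ^ 'v) set" where
  "norm_region r = {x. (\<forall>v. v \<notin> U \<union> V \<longrightarrow> x $ v = 0) \<and> (\<Sum>v\<in>U. x $ v) + (\<Sum>v\<in>V. x $ v) = 0 \<and>
     (\<Sum>v\<in>U. \<bar>x $ v\<bar>) \<le> r \<and> (\<Sum>v\<in>V. \<bar>x $ v\<bar>) \<le> r}"

lemma axis_differencesI:
  assumes "u \<in> U" "v \<in> V"
  shows "axis u 1 - axis v 1 \<in> axis_differences" "axis v 1 - axis u 1 \<in> axis_differences"
  using assms unfolding axis_differences_def by blast+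

lemma axis_differencesE:
  assumes "x \<in> axis_differences"
  obtains u v where "u \<in> U" "v \<in> V" "x = axis u 1 - axis v 1 \<or> x = axis v 1 - axis u 1"
  using assms unfolding axis_differences_def by blast

lemma convex_norm_region: "convex (norm_region r)"
proof (rule convexI)
  fix x y :: "real ^ 'v" and s t :: real
  assume xy: "x \<in> norm_region r" "y \<in> norm_region r" and st: "0 \<le> s" "0 \<le> t" "s + t = 1"
  have norm: "(\<Sum>v\<in>W. \<bar>s * x $ v + t * y $ v\<bar>) \<le> r"
    if "(\<Sum>v\<in>W. \<bar>x $ v\<bar>) \<le> r" "(\<Sum>v\<in>W. \<bar>y $ v\<bar>) \<le> r" for W
  proof -
    have "(\<Sum>v\<in>W. \<bar>s * x $ v + t * y $ v\<bar>) \<le> (\<Sum>v\<in>W. s * \<bar>x $ v\<bar> + t * \<bar>y $ v\<bar>)"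
      using st by (intro sum_mono) (metis abs_mult abs_of_nonneg abs_triangle_ineq)
    also have "\<dots> = s * (\<Sum>v\<in>W. \<bar>x $ v\<bar>) + t * (\<Sum>v\<in>W. \<bar>y $ v\<bar>)"
      by (simp add: sum.distrib sum_distrib_left)
    also have "\<dots> \<le> s * r + t * r"
      using that st by (intro add_mono mult_left_mono)
    finally show ?thesis using st by (simp flip: distrib_right)
  qed
  have "s * (\<Sum>v\<in>U. x $ v) + t * (\<Sum>v\<in>U. y $ v) + (s * (\<Sum>v\<in>V. x $ v) + t * (\<Sum>v\<in>V. y $ v)) =
      s * ((\<Sum>v\<in>U. x $ v) + (\<Sum>v\<in>V. x $ v)) + t * ((\<Sum>v\<in>U. y $ v) + (\<Sum>v\<in>V. y $ v))"
    by (simp add: algebra_simps)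
  then show "s *\<^sub>R x + t *\<^sub>R y \<in> norm_region r"
    using xy norm by (auto simp: norm_region_def sum.distrib simp flip: sum_distrib_left)
qed

lemma axis_differences_subset: "axis_differences \<subseteq> norm_region 1"
proof
  fix x assume "x \<in> axis_differences"
  then obtain u v where uv: "u \<in> U" "v \<in> V" and x: "x = axis u 1 - axis v 1 \<or> x = axis v 1 - axis u 1"
    by (rule axis_differencesE)
  have ne: "v \<notin> U" "u \<notin> V" using uv disjoint by auto
  have zero: "x $ w = 0" if "w \<noteq> u" "w \<noteq> v" for w
    using x that by (auto simp: axis_def)
  have U: "(\<Sum>w\<in>U. h (x $ w)) = h (x $ u)" if "h 0 = 0" for h :: "real \<Rightarrow> real"
  proof -
    have "(\<Sum>w\<in>U. h (x $ w)) = (\<Sum>w\<in>{u}. h (x $ w))"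
      using uv ne that zero by (intro sum.mono_neutral_right) (auto, metis)
    then show ?thesis by simp
  qed
  have V: "(\<Sum>w\<in>V. h (x $ w)) = h (x $ v)" if "h 0 = 0" for h :: "real \<Rightarrow> real"
  proof -
    have "(\<Sum>w\<in>V. h (x $ w)) = (\<Sum>w\<in>{v}. h (x $ w))"
      using uv ne that zero by (intro sum.mono_neutral_right) (auto, metis)
    then show ?thesis by simp
  qed
  show "x \<in> norm_region 1"
    using x uv ne U[of "\<lambda>x. x"] U[of abs] V[of "\<lambda>x. x"] V[of abs]
    by (auto simp: norm_region_def) (auto simp: axis_def)
qed

text \<open>Duality: a point outside the hull would be separated by some \<open>c\<close> with
  \<open>inner c x > M\<close>, although \<open>c\<close> varies by less than \<open>M\<close> along
  each edge. Bounding \<open>inner c x\<close> on each part by sup norm times 1-norm, after a shift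
  of \<open>c\<close>, gives at most \<open>M\<close>.\<close>

lemma norm_region_subset: "norm_region 1 \<subseteq> convex hull axis_differences"
proof
  fix x assume x: "x \<in> norm_region 1"
  have comp: "compact (convex hull axis_differences)"
    by (intro compact_convex_hull finite_imp_compact) (auto simp: axis_differences_def)
  show "x \<in> convex hull axis_differences"
  proof (rule ccontr)
    assume "x \<notin> convex hull axis_differences"
    then obtain c0 m0 where sep0: "inner c0 x < m0" "\<And>y. y \<in> convex hull axis_differences \<Longrightarrow> inner c0 y > m0"
      using separating_hyperplane_closed_point[OF convex_convex_hull compact_imp_closed[OF comp]] by metis
    define c M where "c = - c0" and "M = - m0"
    have sep: "inner c x > M" "\<And>y. y \<in> axis_differences \<Longrightarrow> inner c y < M"
      using sep0 hull_inc[of _ axis_differences convex] by (auto simp: c_def M_def)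
    have edge: "\<bar>c $ u - c $ v\<bar> \<le> M" if "u \<in> U" "v \<in> V" for u v
      using sep(2)[OF axis_differencesI(1)[OF that]] sep(2)[OF axis_differencesI(2)[OF that]]
      by (simp add: inner_diff_right inner_axis)
    \<comment> \<open>Adding a constant to \<open>c\<close> does not change \<open>c \<bullet> x\<close>; centring at the midpoint \<open>s\<close> of the range of
      \<open>c\<close> on \<open>U\<close> makes the sum of the sup norms on \<open>U\<close> and \<open>V\<close> at most \<open>M\<close>.\<close>
    define A where "A = Max ((\<lambda>u. c $ u) ` U)"
    define B where "B = Min ((\<lambda>u. c $ u) ` U)"
    define s where "s = (A + B) / 2"
    define \<alpha> where "\<alpha> = (A - B) / 2"
    define \<beta> where "\<beta> = Max ((\<lambda>v. \<bar>c $ v - s\<bar>) ` V)"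
    have A: "A \<in> (\<lambda>u. c $ u) ` U" and B: "B \<in> (\<lambda>u. c $ u) ` U"
      and \<beta>: "\<beta> \<in> (\<lambda>v. \<bar>c $ v - s\<bar>) ` V"
      unfolding A_def B_def \<beta>_def using nonempty by (auto intro!: Max_in Min_in)
    have le: "c $ u \<le> A" "B \<le> c $ u" if "u \<in> U" for u
      unfolding A_def B_def using that by auto
    have \<alpha>: "\<bar>c $ u - s\<bar> \<le> \<alpha>" if "u \<in> U" for u
      using le[OF that] unfolding s_def \<alpha>_def abs_le_iff by (simp add: field_simps)
    have \<beta>_le: "\<bar>c $ v - s\<bar> \<le> \<beta>" if "v \<in> V" for v
      unfolding \<beta>_def using that by auto
    \<comment> \<open>For each \<open>v\<close> in \<open>V\<close>, the sum of
      \<open>\<alpha>\<close> and the distance from \<open>c $ v\<close> to \<open>s\<close> is the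
      larger of \<open>A - c $ v\<close> and \<open>c $ v - B\<close>, both differences along
      edges.\<close>
    have bound: "\<beta> \<le> M - \<alpha>"
    proof -
      obtain v where v: "v \<in> V" "\<beta> = \<bar>c $ v - s\<bar>" using \<beta> by auto
      obtain u u' where u: "u \<in> U" "A = c $ u" "u' \<in> U" "B = c $ u'" using A B by auto
      show ?thesis
        using edge[OF u(1) v(1)] edge[OF u(3) v(1)] unfolding v(2) s_def \<alpha>_def u(2,4)[symmetric]
        by (intro abs_leI) (simp_all add: abs_le_iff field_simps)
    qed
    have nonneg: "0 \<le> \<alpha>" "0 \<le> \<beta>"
      using \<alpha> \<beta>_le nonempty by (metis abs_ge_zero ex_in_conv order_trans)+
    have part: "(\<Sum>v\<in>W. (c $ v - s) * x $ v) \<le> t"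
      if "\<And>v. v \<in> W \<Longrightarrow> \<bar>c $ v - s\<bar> \<le> t" "0 \<le> t" "(\<Sum>v\<in>W. \<bar>x $ v\<bar>) \<le> 1" for W t
    proof -
      have "(\<Sum>v\<in>W. (c $ v - s) * x $ v) \<le> (\<Sum>v\<in>W. t * \<bar>x $ v\<bar>)"
        using that(1) by (intro sum_mono) (metis abs_ge_self abs_ge_zero abs_mult mult_right_mono order_trans)
      also have "\<dots> = t * (\<Sum>v\<in>W. \<bar>x $ v\<bar>)" by (simp add: sum_distrib_left)
      also have "\<dots> \<le> t" using that(2,3) by (rule mult_left_le[rotated])
      finally show ?thesis .
    qed
    have "inner c x = (\<Sum>v\<in>U. (c $ v - s) * x $ v) + (\<Sum>v\<in>V. (c $ v - s) * x $ v)"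
    proof -
      have "inner c x = (\<Sum>v\<in>U \<union> V. c $ v * x $ v)"
        unfolding inner_vec_def using x by (intro sum.mono_neutral_cong_right) (auto simp: norm_region_def)
      also have "\<dots> = (\<Sum>v\<in>U. c $ v * x $ v) + (\<Sum>v\<in>V. c $ v * x $ v)"
        using disjoint by (intro sum.union_disjoint) auto
      also have "\<dots> = (\<Sum>v\<in>U. c $ v * x $ v) + (\<Sum>v\<in>V. c $ v * x $ v) -
          s * ((\<Sum>v\<in>U. x $ v) + (\<Sum>v\<in>V. x $ v))"
        using x by (simp add: norm_region_def)
      finally show ?thesis
        by (simp add: left_diff_distrib sum_subtractf sum_distrib_left algebra_simps)
    qed
    moreover have "(\<Sum>v\<in>U. (c $ v - s) * x $ v) \<le> \<alpha>" "(\<Sum>v\<in>V. (c $ v - s) * x $ v) \<le> \<beta>"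
      using \<alpha> \<beta>_le nonneg x by (auto intro!: part simp: norm_region_def)
    ultimately show False using sep(1) bound by linarith
  qed
qed

lemma convex_hull_axis_differences: "convex hull axis_differences = norm_region 1"
  by (intro equalityI norm_region_subset hull_minimal axis_differences_subset convex_norm_region)

lemma scaleR_norm_region:
  assumes "0 \<le> r"
  shows "(*\<^sub>R) r ` norm_region 1 = norm_region r"
proof (intro equalityI subsetI)
  fix y assume "y \<in> (*\<^sub>R) r ` norm_region 1"
  then obtain x where x: "x \<in> norm_region 1" "y = r *\<^sub>R x" by auto
  have "r * (\<Sum>v\<in>W. \<bar>x $ v\<bar>) \<le> r" if "(\<Sum>v\<in>W. \<bar>x $ v\<bar>) \<le> 1" for W
    using that assms by (rule mult_left_le)
  moreover have "r * (\<Sum>v\<in>U. x $ v) + r * (\<Sum>v\<in>V. x $ v) = 0"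
    using x by (simp add: norm_region_def flip: distrib_left)
  ultimately show "y \<in> norm_region r"
    using x assms by (simp add: norm_region_def abs_mult flip: sum_distrib_left)
next
  fix y assume y: "y \<in> norm_region r"
  show "y \<in> (*\<^sub>R) r ` norm_region 1"
  proof (cases "r = 0")
    case True
    have "y $ v = 0" for v
    proof (cases "v \<in> U \<union> V")
      case v: True
      have "(\<Sum>v\<in>U. \<bar>y $ v\<bar>) = 0" "(\<Sum>v\<in>V. \<bar>y $ v\<bar>) = 0"
        using y True by (auto simp: norm_region_def intro!: antisym sum_nonneg)
      with v show ?thesis by (auto simp: sum_nonneg_eq_0_iff)
    qed (use y in \<open>auto simp: norm_region_def\<close>)
    then have "y = r *\<^sub>R 0" by (simp add: vec_eq_iff)
    moreover have "0 \<in> norm_region 1" by (simp add: norm_region_def)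
    ultimately show ?thesis by blast
  next
    case False
    with assms have r: "r > 0" by simp
    have "(1 / r) *\<^sub>R y \<in> norm_region 1"
      using y r by (simp add: norm_region_def abs_mult flip: sum_divide_distrib add_divide_distrib)
    moreover have "y = r *\<^sub>R ((1 / r) *\<^sub>R y)" using r by simp
    ultimately show ?thesis by blast
  qed
qed

text \<open>As 0 lies in the region, affine and linear dimension agree; the span is the hyperplane
  of coordinate sum 0 in the coordinate subspace.\<close>

lemma aff_dim_norm_region: "aff_dim (norm_region 1) = int (card U + card V) - 1"
proof -
  have zero: "0 \<in> norm_region 1" by (simp add: norm_region_def)
  have span: "span (norm_region 1) \<subseteq> {x. (\<Sum>v\<in>U. x $ v) + (\<Sum>v\<in>V. x $ v) = 0}"
  proof (rule span_minimal)
    show "subspace {x :: real ^ 'v. (\<Sum>v\<in>U. x $ v) + (\<Sum>v\<in>V. x $ v) = 0}"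
      by (auto simp: subspace_def sum.distrib algebra_simps simp flip: sum_distrib_left distrib_left)
  qed (auto simp: norm_region_def)
  obtain u v where uv: "u \<in> U" "v \<in> V" using nonempty by blast
  \<comment> \<open>One axis vector extends the span to the whole coordinate subspace of \<open>U \<union> V\<close>.\<close>
  define e :: "real ^ 'v" where "e = axis v 1"
  have "v \<notin> U" using uv disjoint by auto
  then have "(\<Sum>w\<in>U. e $ w) + (\<Sum>w\<in>V. e $ w) = 1"
    using uv by (simp add: e_def axis_def if_distrib cong: if_cong) 
  with span have e: "e \<notin> span (norm_region 1)" by auto
  define T where "T = span (insert e (norm_region 1))"
  have sub: "subspace T" by (simp add: T_def)
  have eT: "e \<in> T" and NT: "norm_region 1 \<subseteq> T"
    by (auto simp: T_def intro: span_base)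
  have dT: "axis_differences \<subseteq> T"
    using axis_differences_subset NT by blast
  have uT: "axis w 1 \<in> T" if "w \<in> U" for w
  proof -
    have "(axis w 1 - axis v 1) + e \<in> T"
      using dT axis_differencesI(1)[OF that uv(2)] eT sub by (intro subspace_add) auto
    then show ?thesis by (simp add: e_def)
  qed
  have vT: "axis w 1 \<in> T" if "w \<in> V" for w
  proof -
    have "(axis w 1 - axis u 1) + axis u 1 \<in> T"
      using dT axis_differencesI(2)[OF uv(1) that] uT[OF uv(1)] sub by (intro subspace_add) auto
    then show ?thesis by simp
  qed
  have "T = span ((\<lambda>w. axis w 1) ` (U \<union> V))"
  proof (rule equalityI)
    have "x \<in> span ((\<lambda>w. axis w 1) ` (U \<union> V))" if "\<forall>v. v \<notin> U \<union> V \<longrightarrow> x $ v = 0" for x :: "real ^ 'v"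
    proof -
      have "x = (\<Sum>w\<in>UNIV. x $ w *\<^sub>R axis w 1)"
        by (simp add: basis_expansion flip: scalar_mult_eq_scaleR)
      also have "\<dots> = (\<Sum>w\<in>U \<union> V. x $ w *\<^sub>R axis w 1)"
        using that by (intro sum.mono_neutral_right) auto
      also have "\<dots> \<in> span ((\<lambda>w. axis w 1) ` (U \<union> V))"
        by (intro span_sum span_scale span_base) auto
      finally show ?thesis .
    qed
    moreover have "e \<in> span ((\<lambda>w. axis w 1) ` (U \<union> V))"
      using uv by (auto simp: e_def intro: span_base)
    ultimately show "T \<subseteq> span ((\<lambda>w. axis w 1) ` (U \<union> V))"
      unfolding T_def by (intro span_minimal) (auto simp: norm_region_def)
    show "span ((\<lambda>w. axis w 1) ` (U \<union> V)) \<subseteq> T"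
      using sub uT vT by (intro span_minimal) auto
  qed
  moreover have "dim (span ((\<lambda>w. axis w 1 :: real ^ 'v) ` (U \<union> V))) = card (U \<union> V)"
  proof -
    have "independent ((\<lambda>w. axis w 1 :: real ^ 'v) ` (U \<union> V))"
      by (rule independent_mono[OF independent_Basis]) (auto simp: axis_in_Basis_iff)
    moreover have "inj_on (\<lambda>w. axis w 1 :: real ^ 'v) (U \<union> V)"
      by (auto simp: inj_on_def axis_eq_axis)
    ultimately show ?thesis by (simp add: dim_eq_card_independent card_image)
  qed
  moreover have "dim T = dim (norm_region 1) + 1"
    using e by (simp add: T_def dim_insert)
  moreover have "card (U \<union> V) = card U + card V"
    using disjoint by (simp add: card_Un_disjoint)
  ultimately show ?thesis
    using aff_dim_zero[OF hull_inc[OF zero]] by simp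
qed

lemma card_lattice_points_norm_region:
  assumes "card U = Suc a" "card V = Suc b"
  shows "card (lattice_points (norm_region (real n))) =
    (\<Sum>p\<le>n. signed_count a p (n - p) * signed_count b p (n - p)) +
    (\<Sum>p<n. signed_count a p (n - 1 - p) * signed_count b p (n - 1 - p))"
proof -
  \<comment> \<open>\<open>s\<close> is the common sum of the vector on \<open>U\<close> and the
    negated vector on \<open>V\<close>. It is at most the 1-norm in absolute value, hence its
    range.\<close>
  let ?S = "SIGMA s:{-int n..int n}. sum_fns U n s \<times> sum_fns V n s"
  let ?to = "\<lambda>(s :: int, g :: 'v \<Rightarrow> int, h :: 'v \<Rightarrow> int). (\<chi> v. real_of_int (g v - h v)) :: real ^ 'v"
  let ?from = "\<lambda>x :: real ^ 'v. (\<Sum>v\<in>U. \<lfloor>x $ v\<rfloor>, \<lambda>v. if v \<in> U then \<lfloor>x $ v\<rfloor> else 0, \<lambda>v. if v \<in> V then - \<lfloor>x $ v\<rfloor> else 0)"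
  have notin: "v \<notin> V" if "v \<in> U" for v using that disjoint by auto
  have notin': "v \<notin> U" if "v \<in> V" for v using that disjoint by auto
  \<comment> \<open>On integral vectors floors commute with sums and absolute values, which carries
    the constraints from reals to integers.\<close>
  have int_sum: "(\<Sum>v\<in>W. \<lfloor>x $ v\<rfloor>) = \<lfloor>\<Sum>v\<in>W. x $ v\<rfloor>" "(\<Sum>v\<in>W. \<bar>\<lfloor>x $ v\<rfloor>\<bar>) = \<lfloor>\<Sum>v\<in>W. \<bar>x $ v\<bar>\<rfloor>"
    if "\<forall>v. x $ v \<in> \<int>" for x :: "real ^ 'v" and W
  proof -
    have "x $ v = of_int \<lfloor>x $ v\<rfloor>" for v using that by simp
    then have "(\<Sum>v\<in>W. x $ v) = of_int (\<Sum>v\<in>W. \<lfloor>x $ v\<rfloor>)" "(\<Sum>v\<in>W. \<bar>x $ v\<bar>) = of_int (\<Sum>v\<in>W. \<bar>\<lfloor>x $ v\<rfloor>\<bar>)"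
      by (simp_all add: of_int_abs)
    then show "(\<Sum>v\<in>W. \<lfloor>x $ v\<rfloor>) = \<lfloor>\<Sum>v\<in>W. x $ v\<rfloor>" "(\<Sum>v\<in>W. \<bar>\<lfloor>x $ v\<rfloor>\<bar>) = \<lfloor>\<Sum>v\<in>W. \<bar>x $ v\<bar>\<rfloor>"
      by (simp_all only: floor_of_int)
  qed
  have "bij_betw ?to ?S (lattice_points (norm_region (real n)))"
  proof (rule bij_betw_byWitness[where f' = ?from])
    show "\<forall>z\<in>?S. ?from (?to z) = z"
      using notin by (force simp: sum_fns_def fun_eq_iff simp flip: of_int_diff intro!: sum.cong)
    show "\<forall>x\<in>lattice_points (norm_region (real n)). ?to (?from x) = x"
    proof
      fix x assume x: "x \<in> lattice_points (norm_region (real n))"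
      have "real_of_int ((if v \<in> U then \<lfloor>x $ v\<rfloor> else 0) - (if v \<in> V then - \<lfloor>x $ v\<rfloor> else 0)) = x $ v" for v
        using x notin by (auto simp: lattice_points_def norm_region_def)
      then show "?to (?from x) = x" by (simp add: vec_eq_iff)
    qed
    show "?to ` ?S \<subseteq> lattice_points (norm_region (real n))"
    proof clarify
      fix s g h assume gh: "g \<in> sum_fns U n s" "h \<in> sum_fns V n s"
      have U: "(\<Sum>v\<in>U. k (g v - h v)) = (\<Sum>v\<in>U. k (g v))" for k :: "int \<Rightarrow> int"
        using gh notin by (intro sum.cong) (auto simp: sum_fns_def)
      have V: "(\<Sum>v\<in>V. k (g v - h v)) = (\<Sum>v\<in>V. k (- h v))" for k :: "int \<Rightarrow> int"
        using gh notin' by (intro sum.cong) (auto simp: sum_fns_def)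
      have "(\<Sum>v\<in>U. g v - h v) = s" "(\<Sum>v\<in>V. g v - h v) = - s"
        "(\<Sum>v\<in>U. \<bar>g v - h v\<bar>) \<le> int n" "(\<Sum>v\<in>V. \<bar>g v - h v\<bar>) \<le> int n"
        using U[of "\<lambda>x. x"] U[of abs] V[of "\<lambda>x. x"] V[of abs] gh
        by (auto simp: sum_fns_def sum_negf)
      then have "(\<Sum>v\<in>U. real_of_int (g v - h v)) = s" "(\<Sum>v\<in>V. real_of_int (g v - h v)) = - s"
        "(\<Sum>v\<in>U. \<bar>real_of_int (g v - h v)\<bar>) \<le> n" "(\<Sum>v\<in>V. \<bar>real_of_int (g v - h v)\<bar>) \<le> n"
        by (simp_all only: of_int_abs[symmetric] of_int_sum[symmetric] of_int_minus)
      then show "(\<chi> v. real_of_int (g v - h v)) \<in> lattice_points (norm_region (real n))"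
        using gh by (auto simp: lattice_points_def norm_region_def sum_fns_def)
    qed
    show "?from ` lattice_points (norm_region (real n)) \<subseteq> ?S"
    proof
      fix z assume "z \<in> ?from ` lattice_points (norm_region (real n))"
      then obtain x :: "real ^ 'v" where z: "z = ?from x" and x: "x \<in> norm_region (real n)" "\<forall>v. x $ v \<in> \<int>"
        by (auto simp: lattice_points_def)
      have "(\<Sum>v\<in>U. x $ v) \<in> \<int>" using x(2) by (intro Ints_sum) auto
      then have V: "(\<Sum>v\<in>V. \<lfloor>x $ v\<rfloor>) = - (\<Sum>v\<in>U. \<lfloor>x $ v\<rfloor>)"
        using x by (auto simp: int_sum norm_region_def elim!: Ints_cases dest!: add_eq_0_iff[THEN iffD1]) 
      have abs: "(\<Sum>v\<in>U. \<bar>\<lfloor>x $ v\<rfloor>\<bar>) \<le> int n" "(\<Sum>v\<in>V. \<bar>\<lfloor>x $ v\<rfloor>\<bar>) \<le> int n"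
        using x by (auto simp: int_sum norm_region_def floor_le_iff)
      moreover have "\<bar>\<Sum>v\<in>U. \<lfloor>x $ v\<rfloor>\<bar> \<le> (\<Sum>v\<in>U. \<bar>\<lfloor>x $ v\<rfloor>\<bar>)" by (rule sum_abs)
      ultimately show "z \<in> ?S"
        using V unfolding z by (auto simp: sum_fns_def sum_negf abs_le_iff if_distrib[of abs] cong: if_cong)
    qed
  qed
  then have "card (lattice_points (norm_region (real n))) = card ?S"
    by (rule bij_betw_same_card[symmetric])
  also have "\<dots> = (\<Sum>s\<in>{-int n..int n}. card (sum_fns U n s) * card (sum_fns V n s))"
    by (subst card_SigmaI) (auto simp: finite_sum_fns card_cartesian_product)
  finally show ?thesis
    using assms by (simp add: sum_by_parity sum_fns_even sum_fns_odd card_signed_fns)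
qed

lemma ehrhart_series_norm_region:
  assumes "card U = Suc a" "card V = Suc b"
  shows "ehrhart_series (norm_region 1) = (1 + fps_X) * diagonal_series a b"
proof (rule fps_ext)
  fix n
  show "ehrhart_series (norm_region 1) $ n = ((1 + fps_X) * diagonal_series a b) $ n"
    unfolding ehrhart_series_def
    \<comment> \<open>The second sum of the lattice point count is coefficient \<open>n - 1\<close>
      of \<open>diagonal_series a b\<close>; for \<open>n = 0\<close> it is empty, as multiplication
      by \<open>fps_X\<close> requires.\<close>
    by (cases n) (simp_all add: scaleR_norm_region card_lattice_points_norm_region[OF assms]
      distrib_right diagonal_series_def lessThan_Suc_atMost del: sum.atMost_Suc of_nat_Suc)
qed

end

section \<open>Gamma-positivity\<close>

text \<open>\<open>gamma_positive\<close> refers to the actual degree, so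
  \<open>degree f = d\<close> has to be shown: summand \<open>i\<close> has degree at most
  \<open>d - i\<close>, hence coefficient \<open>d\<close> comes from \<open>i = 0\<close> alone and
  equals \<open>\<gamma> 0\<close>.\<close>

lemma gamma_positiveI:
  fixes \<gamma> :: "nat \<Rightarrow> real"
  assumes nonneg: "\<And>i. \<gamma> i \<ge> 0" and "\<gamma> 0 \<noteq> 0"
    and f: "f = (\<Sum>i\<le>d div 2. smult (\<gamma> i) (monom 1 i * [:1, 1:] ^ (d - 2 * i)))"
  shows "gamma_positive f"
proof -
  let ?g = "\<lambda>i. smult (\<gamma> i) (monom 1 i * [:1, 1:] ^ (d - 2 * i))"
  have deg: "degree (?g i) \<le> d - i" if "2 * i \<le> d" for i
  proof -
    have "degree (?g i) \<le> degree (monom 1 i * [:1, 1::real:] ^ (d - 2 * i))" by simp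
    also have "\<dots> \<le> degree (monom (1::real) i) + degree ([:1, 1::real:] ^ (d - 2 * i))"
      by (rule degree_mult_le)
    also have "\<dots> = i + (d - 2 * i)" by (simp add: degree_monom_eq degree_power_eq)
    finally show ?thesis using that by simp
  qed
  have "degree f \<le> d"
    unfolding f by (intro degree_sum_le finite_atMost order_trans[OF deg diff_le_self]) auto
  moreover have "coeff f d = \<gamma> 0"
  proof -
    have "coeff f d = (\<Sum>i\<le>d div 2. coeff (?g i) d)"
      unfolding f by (rule coeff_sum)
    also have "\<dots> = (\<Sum>i\<in>{0}. coeff (?g i) d)"
    proof (rule sum.mono_neutral_right)
      show "\<forall>i\<in>{..d div 2} - {0}. coeff (?g i) d = 0"
      proof
        fix i assume i: "i \<in> {..d div 2} - {0}"
        then have "2 * i \<le> d" "0 < i" by auto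
        with deg[of i] have "degree (?g i) < d" by linarith
        then show "coeff (?g i) d = 0" by (rule coeff_eq_0)
      qed
    qed auto
    also have "\<dots> = \<gamma> 0 * lead_coeff ([:1, 1:] ^ d)"
      by (simp add: degree_power_eq flip: one_pCons)
    finally show ?thesis by (simp add: lead_coeff_power)
  qed
  ultimately have "degree f = d"
    using \<open>\<gamma> 0 \<noteq> 0\<close> by (metis le_antisym le_degree)
  with nonneg f show ?thesis unfolding gamma_positive_def by metis
qed

section \<open>The h-star polynomial of complete bipartite graphs\<close>

theorem theorem4p1:
  fixes a b :: nat and G :: "('v::finite, 'e) pre_digraph"
  assumes "K\<^bsub>a + 1, b + 1\<^esub> G"
  shows "h_star (symmetric_edge_polytope G) =
           (\<Sum>i = 0..min a b. of_nat (((2 * i) choose i) * (a choose i) * (b choose i)) *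
              monom 1 i * [:1, 1:] ^ (a + b + 1 - 2 * i)) \<and>
         gamma_positive (h_star (symmetric_edge_polytope G))"
proof -
  obtain U V where UV: "U \<inter> V = {}" "card U = Suc a" "card V = Suc b"
    and ends: "arcs_ends G = U \<times> V \<union> V \<times> U"
    using assms unfolding complete_bipartite_digraph_def by auto
  interpret bipartite_axes U V
    using UV by unfold_locales auto
  define c where "c i = ((2 * i) choose i) * (a choose i) * (b choose i)" for i
  define h :: "real poly" where
    "h = (\<Sum>i = 0..min a b. of_nat (c i) * monom 1 i * [:1, 1:] ^ (a + b + 1 - 2 * i))"
  have P: "symmetric_edge_polytope G = norm_region 1"
    unfolding symmetric_edge_polytope_def ends
    by (simp only: convex_hull_axis_differences flip: axis_differences_def)
  have dim: "nat (aff_dim (norm_region 1)) + 1 = a + b + 2"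
    by (simp add: aff_dim_norm_region UV)
  have "(1 + fps_X) * (\<Sum>m\<le>a. of_nat (c m) * fps_X ^ m * (1 + fps_X) ^ (a + b - 2 * m)) =
      (1 + fps_X) * (\<Sum>m = 0..min a b. of_nat (c m) * fps_X ^ m * (1 + fps_X :: real fps) ^ (a + b - 2 * m))"
    by (intro arg_cong2[where f = "(*)"] refl sum.mono_neutral_right) (auto simp: c_def binomial_eq_0)
  also have "\<dots> = fps_of_poly h"
    unfolding h_def sum_distrib_left fps_of_poly_sum
  proof (intro sum.cong refl, goal_cases)
    case (1 i)
    \<comment> \<open>As \<open>i \<le> min a b\<close>, the subtraction is exact, and the extra
      factor \<open>1 + fps_X\<close> raises the exponent by one.\<close>
    then have *: "a + b + 1 - 2 * i = Suc (a + b - 2 * i)" by auto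
    have linear: "fps_of_poly [:1, 1:] = (1 + fps_X :: real fps)"
      by (simp add: fps_of_poly_linear add.commute)
    have "fps_of_poly (of_nat (c i)) = (of_nat (c i) :: real fps)"
      by (simp add: of_nat_poly fps_of_poly_const fps_of_nat)
    then show ?case
      unfolding * by (simp only: fps_of_poly_mult fps_of_poly_power linear fps_of_poly_monom' power_Suc mult_ac)
  qed
  finally have "ehrhart_series (norm_region 1) = fps_of_poly h * inverse ((1 - fps_X) ^ (a + b + 2))"
    unfolding ehrhart_series_norm_region[OF UV(2,3)] diagonal_series_eq c_def by (simp only: mult.assoc[symmetric])
  then have h: "h_star (symmetric_edge_polytope G) = h"
    unfolding P by (intro h_star_eqI, unfold dim, subst fps_divide_unit) (simp_all add: fps_power_zeroth)
  \<comment> \<open>Since \<open>min a b \<le> (a + b + 1) div 2\<close>, the longer range adds only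
    zero terms. The required \<open>c 0 \<noteq> 0\<close> holds as \<open>c 0 = 1\<close>.\<close>
  have "h = (\<Sum>i\<le>(a + b + 1) div 2. smult (real (c i)) (monom 1 i * [:1, 1:] ^ (a + b + 1 - 2 * i)))"
    unfolding h_def by (rule sum.mono_neutral_cong_left) (auto simp: c_def binomial_eq_0 of_nat_poly)
  then have "gamma_positive h"
    by (rule gamma_positiveI[rotated 2]) (auto simp: c_def)
  with h show ?thesis by (simp add: h_def c_def)
qed

end
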